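(* Let $X,X_1$ be real separable Hilbert spaces such that $X$ is compactly and continuously embedded in $X_1$, and let $X^*$ be the dual space of $X$. Assume the following. 1) $J:X\to[0,+\infty]$ is a proper lower semicontinuous convex functional with $J(0_X)=0$. 2) $a_0:X\times X\to\mathbb R$ is a bilinear form such that $|a_0(u,v)|\le K\|u\|_X\|v\|_X$ for all $u,v\in X$, and for some $\alpha>0$, $a_0(u,u)\ge\alpha\|u\|_X^2$ for all $u\in X$. 3) $a_1:X_1\times X\times X\to\mathbb R$ is a trilinear functional such that $a_1(w,u,u)=0$ for all $w\in X_1$, $u\in X$, and $|a_1(w,u,v)|\le K\|w\|_{X_1}\|u\|_X\|v\|_X$ for all $w\in X_1$, $u,v\in X$. Then for every $f\in X^*$ there exists a solution $v\in X$ to the variational inequality $$a_0(v,u-v)+a_1(v,v,u-v)+J(u)-J(v)\ge\langle f,u-v\rangle\quad\forall u\in X,$$ and all solutions $v$ satisfy the estimate $$\|v\|_X\le\frac1\alpha\|f\|_{X^*}.$$ In addition, if $$\frac{Kc}{\alpha^2}\|f\|_{X^*}<1,$$ where $c$ is a constant with $\|\cdot\|_{X_1}\le c\|\cdot\|_X$ on $X$, then the solution is unique.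
   Context: A functional $J:X\to\mathbb R\cup\{+\infty\}$ is proper if it is not identically $+\infty$. $\langle\cdot,\cdot\rangle$ is the duality pairing between $X^*$ and $X$. $0_X$ is the zero element of $X$. A solution $v$ of the variational inequality is understood to satisfy $J(v)<+\infty$. *)

theory Defs
  imports "HOL-Analysis.Analysis"
begin

text \<open>
  Real Hilbert spaces are types of sort \<open>{real_inner, complete_space}\<close>. Since the two spaces are
  distinct types, the inclusion of \<open>X\<close> into \<open>X\<^sub>1\<close> is given by an injective bounded linear map \<open>\<iota>\<close>,
  and an element \<open>v\<close> of \<open>X\<close>, viewed as an element of \<open>X\<^sub>1\<close>, is \<open>\<iota> v\<close>. The embedding is compact if
  bounded subsets of \<open>X\<close> are relatively compact in \<open>X\<^sub>1\<close>.
\<close>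

definition continuous_embedding ::
    "('a::real_normed_vector \<Rightarrow> 'b::real_normed_vector) \<Rightarrow> bool" where
  "continuous_embedding \<iota> \<longleftrightarrow> bounded_linear \<iota> \<and> inj \<iota>"

definition compact_embedding ::
    "('a::real_normed_vector \<Rightarrow> 'b::real_normed_vector) \<Rightarrow> bool" where
  "compact_embedding \<iota> \<longleftrightarrow>
     continuous_embedding \<iota> \<and> (\<forall>B. bounded B \<longrightarrow> compact (closure (\<iota> ` B)))"

definition trilinear ::
    "('a::real_vector \<Rightarrow> 'b::real_vector \<Rightarrow> 'c::real_vector \<Rightarrow> 'd::real_vector) \<Rightarrow> bool" where
  "trilinear a \<longleftrightarrow>
     (\<forall>u v. linear (\<lambda>w. a w u v)) \<and>
     (\<forall>w v. linear (\<lambda>u. a w u v)) \<and>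
     (\<forall>w u. linear (\<lambda>v. a w u v))"

definition proper_functional :: "('a \<Rightarrow> ereal) \<Rightarrow> bool" where
  "proper_functional J \<longleftrightarrow> (\<exists>u. J u \<noteq> \<infinity>)"

definition lower_semicontinuous :: "('a::topological_space \<Rightarrow> ereal) \<Rightarrow> bool" where
  "lower_semicontinuous J \<longleftrightarrow> (\<forall>u. J u \<le> Liminf (at u) J)"

text \<open>
  \<open>convex_on\<close> is restricted to real-valued functions. In the following version, used for
  functionals without the value \<open>-\<infinity>\<close>, the convention \<open>0 * \<infinity> = 0\<close> of \<open>ereal\<close> makes the cases
  \<open>s = 0\<close> and \<open>t = 0\<close> trivial.
\<close>

definition convex_functional :: "('a::real_vector \<Rightarrow> ereal) \<Rightarrow> bool" where
  "convex_functional J \<longleftrightarrow>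
     (\<forall>u v. \<forall>s\<ge>0. \<forall>t\<ge>0. s + t = 1 \<longrightarrow>
        J (s *\<^sub>R u + t *\<^sub>R v) \<le> ereal s * J u + ereal t * J v)"

text \<open>
  The condition \<open>J v < \<infinity>\<close> is part of the notion of solution; it also excludes the degenerate
  case \<open>\<infinity> - \<infinity> = \<infinity>\<close> of \<open>ereal\<close> in the inequality. The dual space is \<open>'a \<Rightarrow>\<^sub>L real\<close>
  with the operator norm, and the duality pairing is application.
\<close>

definition vi_solution ::
    "('a::real_normed_vector \<Rightarrow> 'b) \<Rightarrow> ('a \<Rightarrow> 'a \<Rightarrow> real) \<Rightarrow> ('b \<Rightarrow> 'a \<Rightarrow> 'a \<Rightarrow> real) \<Rightarrow>
     ('a \<Rightarrow> ereal) \<Rightarrow> ('a \<Rightarrow>\<^sub>L real) \<Rightarrow> 'a \<Rightarrow> bool" where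
  "vi_solution \<iota> a\<^sub>0 a\<^sub>1 J f v \<longleftrightarrow>
     J v < \<infinity> \<and>
     (\<forall>u. ereal (a\<^sub>0 v (u - v) + a\<^sub>1 (\<iota> v) v (u - v)) + J u - J v
            \<ge> ereal (blinfun_apply f (u - v)))"

end

theory Submission
  imports Defs
begin

text \<open>
  Replace \<open>J\<close> by its epigraph \<open>E\<close>, a closed convex subset of \<open>X \<times> \<real>\<close>. For a fixed first argument
  \<open>w \<in> X\<^sub>1\<close> of \<open>a\<^sub>1\<close>, the form \<open>a\<^sub>0 + a\<^sub>1(w, \<cdot>, \<cdot>)\<close> is bounded and coercive with the same constant
  \<open>\<alpha>\<close>, so the variational inequality has a solution \<open>T w\<close> (Lions--Stampacchia). Testing with \<open>0\<close>
  gives \<open>\<parallel>T w\<parallel> \<le> \<parallel>f\<parallel> / \<alpha>\<close>, and testing two inequalities against each other's solutions shows that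
  \<open>T\<close> is Lipschitz from \<open>X\<^sub>1\<close> to \<open>X\<close>. Hence \<open>\<iota> \<circ> T\<close> is a Lipschitz self-map of \<open>X\<^sub>1\<close> with relatively
  compact range, and Schauder's theorem yields \<open>\<iota> (T w) = w\<close>; then \<open>T w\<close> is a solution. The same
  comparison of two solutions gives uniqueness for small \<open>f\<close>.
\<close>

section \<open>Schauder's fixed point theorem\<close>

text \<open>
  The dimension \<open>n\<close> of the cube has to be a variable, because it is the size of a net; this rules
  out the library version of Brouwer's theorem, whose dimension is a type. Kuhn's combinatorial
  lemma behind it has no such restriction.
\<close>

lemma approx_fixed_point_cube:
  fixes F :: "(nat \<Rightarrow> real) \<Rightarrow> nat \<Rightarrow> real"
  assumes range: "\<And>x i. (\<forall>j<n. x j \<in> {0..1}) \<Longrightarrow> i < n \<Longrightarrow> F x i \<in> {0..1}"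
    and ucont: "\<And>e. e > 0 \<Longrightarrow> \<exists>d>0. \<forall>x y. (\<forall>j<n. x j \<in> {0..1}) \<longrightarrow> (\<forall>j<n. y j \<in> {0..1}) \<longrightarrow>
      (\<forall>j<n. \<bar>x j - y j\<bar> < d) \<longrightarrow> (\<forall>i<n. \<bar>F x i - F y i\<bar> < e)"
    and "e > 0"
  obtains x where "\<And>j. j < n \<Longrightarrow> x j \<in> {0..1}" "\<And>i. i < n \<Longrightarrow> \<bar>F x i - x i\<bar> < e"
proof -
  obtain d where "d > 0" and d: "\<And>x y i. \<lbrakk>\<forall>j<n. x j \<in> {0..1}; \<forall>j<n. y j \<in> {0..1};
      \<forall>j<n. \<bar>x j - y j\<bar> < d; i < n\<rbrakk> \<Longrightarrow> \<bar>F x i - F y i\<bar> < e / 2"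
    using ucont[of "e / 2"] \<open>e > 0\<close> by (metis half_gt_zero)
  obtain p :: nat where "p > 0" and p: "1 / real p < min d (e / 2)"
    using real_arch_inverse[of "min d (e / 2)"] \<open>d > 0\<close> \<open>e > 0\<close>
    by (metis gr0I inverse_eq_divide min_less_iff_conj half_gt_zero)
  define g :: "(nat \<Rightarrow> nat) \<Rightarrow> nat \<Rightarrow> real" where "g = (\<lambda>x i. real (x i) / real p)"
  \<comment> \<open>Label 0 records that \<open>F\<close> does not decrease coordinate
    \<open>i\<close>. Kuhn's lemma wants label 0 on the face \<open>x i = 0\<close>, where it
    follows from \<open>F \<ge> 0\<close>, and label 1 on the face \<open>x i = p\<close>, where it
    is imposed and agrees with \<open>F \<le> 1\<close>.\<close>
  define label :: "(nat \<Rightarrow> nat) \<Rightarrow> nat \<Rightarrow> nat" where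
    "label = (\<lambda>x i. if g x i \<le> F (g x) i \<and> x i \<noteq> p then 0 else 1)"
  have g01: "\<forall>j<n. g x j \<in> {0..1}" if "\<forall>j<n. x j \<le> p" for x
    using that \<open>p > 0\<close> by (auto simp: g_def divide_le_eq_1)
  have label01: "label x i = 0 \<or> label x i = 1" for x i
    by (simp add: label_def)
  have label0: "g x i \<le> F (g x) i" if "label x i = 0" for x i
    using that by (auto simp: label_def split: if_splits)
  have label1: "F (g x) i \<le> g x i" if "label x i \<noteq> 0" "i < n" "\<forall>j<n. x j \<le> p" for x i
    using that range[OF g01[OF that(3)], of i] \<open>p > 0\<close>
    by (auto simp: label_def g_def split: if_splits)
  obtain q where q: "\<forall>i<n. q i < p"
    and qrs: "\<forall>i<n. \<exists>r s. (\<forall>j<n. q j \<le> r j \<and> r j \<le> q j + 1) \<and>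
      (\<forall>j<n. q j \<le> s j \<and> s j \<le> q j + 1) \<and> label r i \<noteq> label s i"
  proof (rule kuhn_lemma[OF \<open>p > 0\<close>, of n label])
    show "\<forall>x. (\<forall>i<n. x i \<le> p) \<longrightarrow> (\<forall>i<n. x i = 0 \<longrightarrow> label x i = 0)"
    proof (intro allI impI)
      fix x :: "nat \<Rightarrow> nat" and i
      assume "\<forall>i<n. x i \<le> p" "i < n" "x i = 0"
      then show "label x i = 0"
        using range[OF g01, of x i] \<open>p > 0\<close> by (auto simp: label_def g_def)
    qed
  qed (auto simp: label_def)
  have near: "\<bar>F (g q) i - F (g r) i\<bar> < e / 2" "\<bar>g q i - g r i\<bar> < e / 2" "\<forall>j<n. r j \<le> p"
    if r: "\<forall>j<n. q j \<le> r j \<and> r j \<le> q j + 1" and "i < n" for r i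
  proof -
    have "\<bar>g q j - g r j\<bar> \<le> 1 / real p" if "j < n" for j
    proof -
      have "\<bar>real (q j) - real (r j)\<bar> \<le> 1"
        using r that of_nat_mono[of "q j" "r j", where 'a = real]
          of_nat_mono[of "r j" "q j + 1", where 'a = real] by simp
      then show ?thesis
        using \<open>p > 0\<close> by (simp add: g_def flip: diff_divide_distrib) (simp add: divide_right_mono)
    qed
    then have "\<forall>j<n. \<bar>g q j - g r j\<bar> < d" "\<bar>g q i - g r i\<bar> < e / 2"
      using p \<open>i < n\<close> by fastforce+
    moreover have rp: "\<forall>j<n. r j \<le> p"
      using r q by (metis Suc_eq_plus1 Suc_leI le_trans)
    moreover have "\<forall>j<n. q j \<le> p"
      using q by (auto intro: less_imp_le)
    ultimately show "\<bar>F (g q) i - F (g r) i\<bar> < e / 2" "\<bar>g q i - g r i\<bar> < e / 2" "\<forall>j<n. r j \<le> p"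
      using d[OF g01 g01, of q r i] \<open>i < n\<close> by auto
  qed
  show thesis
  proof (rule that[of "g q"])
    show "g q j \<in> {0..1}" if "j < n" for j
      using g01[of q] q that by (auto intro: less_imp_le)
    show "\<bar>F (g q) i - g q i\<bar> < e" if "i < n" for i
    proof -
      obtain r s where rs: "\<forall>j<n. q j \<le> r j \<and> r j \<le> q j + 1"
          "\<forall>j<n. q j \<le> s j \<and> s j \<le> q j + 1" and "label r i \<noteq> label s i"
        using qrs \<open>i < n\<close> by blast
      \<comment> \<open>At \<open>r'\<close> and \<open>s'\<close> the quantity
        \<open>F - id\<close> has opposite signs in coordinate \<open>i\<close>. Passing from either
        vertex to \<open>q\<close> costs \<open>e / 2\<close> for \<open>F\<close> and
        \<open>e / 2\<close> for the coordinate.\<close>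
      then obtain r' s' where "label r' i = 0" "label s' i \<noteq> 0"
          and rs': "\<forall>j<n. q j \<le> r' j \<and> r' j \<le> q j + 1" "\<forall>j<n. q j \<le> s' j \<and> s' j \<le> q j + 1"
        by (metis label01)
      then have "g r' i \<le> F (g r') i" "F (g s') i \<le> g s' i"
        using near(3)[OF rs'(2)] label0[of r' i] label1[of s' i] \<open>i < n\<close> by auto
      then show ?thesis
        using near(1,2)[OF rs'(1) \<open>i < n\<close>] near(1,2)[OF rs'(2) \<open>i < n\<close>] by linarith
    qed
  qed
qed

text \<open>The weights are tent functions around the points of a finite \<epsilon>-net, normalised
  to sum 1. Only net points closer than \<epsilon> to \<open>z\<close> carry weight, so their
  weighted mean stays within \<epsilon> of \<open>z\<close>.\<close>

lemma schauder_projection: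
  fixes M :: "'a::real_normed_vector set"
  assumes "compact M" "\<epsilon> > 0"
  obtains n :: nat and y :: "nat \<Rightarrow> 'a" and \<mu> :: "nat \<Rightarrow> 'a \<Rightarrow> real"
  where "\<And>i. continuous_on M (\<mu> i)" "\<And>i z. z \<in> M \<Longrightarrow> i < n \<Longrightarrow> \<mu> i z \<in> {0..1}"
    "\<And>z. z \<in> M \<Longrightarrow> norm ((\<Sum>i<n. \<mu> i z *\<^sub>R y i) - z) \<le> \<epsilon>"
proof -
  obtain k where "finite k" and k: "M \<subseteq> (\<Union>x\<in>k. ball x \<epsilon>)"
    using compact_eq_totally_bounded[THEN iffD1, OF \<open>compact M\<close>] \<open>\<epsilon> > 0\<close> by metis
  obtain n :: nat and y where y: "k = y ` {i. i < n}"
    using finite_imp_nat_seg_image_inj_on[OF \<open>finite k\<close>] by metis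
  define \<phi> where "\<phi> = (\<lambda>i z. max 0 (\<epsilon> - dist (y i) z))"
  define \<sigma> where "\<sigma> = (\<lambda>z. \<Sum>i<n. \<phi> i z)"
  have \<phi>0: "\<phi> i z \<ge> 0" for i z
    by (simp add: \<phi>_def)
  have \<sigma>: "\<sigma> z > 0" if "z \<in> M" for z
  proof -
    obtain i where "i < n" "dist (y i) z < \<epsilon>"
      using k y \<open>z \<in> M\<close> by auto
    then show ?thesis
      unfolding \<sigma>_def by (intro sum_pos2[of _ i]) (auto simp: \<phi>_def)
  qed
  show thesis
  proof (rule that)
    show "continuous_on M (\<lambda>z. \<phi> i z / \<sigma> z)" for i
      unfolding \<sigma>_def \<phi>_def
      by (intro continuous_intros) (use \<sigma> in \<open>force simp: \<sigma>_def \<phi>_def\<close>)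
    show "\<phi> i z / \<sigma> z \<in> {0..1}" if "z \<in> M" "i < n" for i z
      using \<sigma>[OF that(1)] \<phi>0 member_le_sum[of i "{..<n}" "\<lambda>i. \<phi> i z"] that(2)
      by (auto simp: \<sigma>_def)
    show "norm ((\<Sum>i<n. (\<phi> i z / \<sigma> z) *\<^sub>R y i) - z) \<le> \<epsilon>" if "z \<in> M" for z
    proof -
      have "(\<Sum>i<n. \<phi> i z / \<sigma> z) = 1"
        using \<sigma>[OF that] by (simp add: \<sigma>_def flip: sum_divide_distrib)
      then have "(\<Sum>i<n. (\<phi> i z / \<sigma> z) *\<^sub>R y i) - z = (\<Sum>i<n. (\<phi> i z / \<sigma> z) *\<^sub>R (y i - z))"
        by (simp add: scaleR_diff_right sum_subtractf flip: scaleR_sum_left)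
      also have "norm \<dots> \<le> (\<Sum>i<n. (\<phi> i z / \<sigma> z) * \<epsilon>)"
      proof (rule sum_norm_le)
        fix i
        have "\<phi> i z * norm (y i - z) \<le> \<phi> i z * \<epsilon>"
          by (cases "dist (y i) z < \<epsilon>") (auto simp: \<phi>_def dist_norm intro: mult_left_mono)
        then show "norm ((\<phi> i z / \<sigma> z) *\<^sub>R (y i - z)) \<le> \<phi> i z / \<sigma> z * \<epsilon>"
          using \<sigma>[OF that] \<phi>0[of i z] by (simp add: divide_right_mono)
      qed
      also have "\<dots> = \<epsilon>"
        using \<open>(\<Sum>i<n. \<phi> i z / \<sigma> z) = 1\<close> by (metis mult_1 sum_distrib_right)
      finally show ?thesis .
    qed
  qed
qed

text \<open>The weights of \<open>S (P x)\<close> define a self-map of the cube, and an almost fixed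
  \<open>x\<close> of it yields the point \<open>P x\<close>. Since \<open>S\<close> is defined on
  the whole space, \<open>P x\<close> may leave the convex hull of the net, and a cube can replace
  the usual simplex.\<close>

lemma schauder_approx_fixed_point:
  fixes S :: "'a::real_normed_vector \<Rightarrow> 'a"
  assumes "uniformly_continuous_on UNIV S" "compact M" "range S \<subseteq> M" "\<epsilon> > 0"
  obtains w where "norm (S w - w) < \<epsilon>"
proof -
  have SM: "S w \<in> M" for w
    using assms(3) by auto
  obtain n :: nat and y \<mu> where \<mu>: "\<And>i. continuous_on M (\<mu> i)"
      "\<And>i z. z \<in> M \<Longrightarrow> i < n \<Longrightarrow> \<mu> i z \<in> {0..1::real}"
    and \<mu>y: "\<And>z. z \<in> M \<Longrightarrow> norm ((\<Sum>i<n. \<mu> i z *\<^sub>R y i) - z) \<le> \<epsilon> / 2"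
    by (rule schauder_projection[OF \<open>compact M\<close> half_gt_zero[OF \<open>\<epsilon> > 0\<close>]]) (rule that)
  \<comment> \<open>The summand 1 keeps \<open>N\<close> positive even for an empty net and makes
    the later estimates strict.\<close>
  define N where "N = 1 + (\<Sum>i<n. norm (y i))"
  have "N > 0"
    unfolding N_def by (intro add_pos_nonneg sum_nonneg) auto
  define P where "P = (\<lambda>x. \<Sum>i<n. x i *\<^sub>R y i)"
  have P: "norm (P x - P x') \<le> d * (\<Sum>i<n. norm (y i))" if "\<forall>i<n. \<bar>x i - x' i\<bar> < d" for x x' d
  proof -
    have "norm (P x - P x') \<le> (\<Sum>i<n. d * norm (y i))"
      unfolding P_def sum_subtractf[symmetric] scaleR_diff_left[symmetric]
      using that by (intro sum_norm_le) (auto intro!: mult_right_mono intro: less_imp_le)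
    then show ?thesis
      by (simp add: sum_distrib_left)
  qed
  obtain x where x: "\<And>i. i < n \<Longrightarrow> \<bar>\<mu> i (S (P x)) - x i\<bar> < \<epsilon> / (2 * N)"
  proof (rule approx_fixed_point_cube[of n "\<lambda>x i. \<mu> i (S (P x))" "\<epsilon> / (2 * N)"])
    show "\<mu> i (S (P x)) \<in> {0..1}" if "i < n" for x i
      using \<mu>(2) SM that by blast
    show "\<epsilon> / (2 * N) > 0"
      using \<open>\<epsilon> > 0\<close> \<open>N > 0\<close> by simp
    fix e :: real
    assume "e > 0"
    have "\<exists>d>0. \<forall>z\<in>M. \<forall>z'\<in>M. dist z z' < d \<longrightarrow> (\<forall>i<k. \<bar>\<mu> i z - \<mu> i z'\<bar> < e)" for k
    proof (induction k)
      case (Suc k)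
      then obtain d where "d > 0"
        "\<And>z z'. \<lbrakk>z \<in> M; z' \<in> M; dist z z' < d\<rbrakk> \<Longrightarrow> \<forall>i<k. \<bar>\<mu> i z - \<mu> i z'\<bar> < e"
        by blast
      moreover obtain d' where "d' > 0"
        "\<And>z z'. \<lbrakk>z \<in> M; z' \<in> M; dist z z' < d'\<rbrakk> \<Longrightarrow> \<bar>\<mu> k z - \<mu> k z'\<bar> < e"
        using compact_uniformly_continuous[OF \<mu>(1) \<open>compact M\<close>, of k] \<open>e > 0\<close>
        unfolding uniformly_continuous_on_def dist_real_def by metis
      ultimately show ?case
        by (intro exI[of _ "min d d'"]) (auto simp: less_Suc_eq)
    qed (auto intro: zero_less_one)
    then obtain d1 where "d1 > 0" and d1:
      "\<And>z z' i. \<lbrakk>z \<in> M; z' \<in> M; dist z z' < d1; i < n\<rbrakk> \<Longrightarrow> \<bar>\<mu> i z - \<mu> i z'\<bar> < e"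
      by meson
    obtain d2 where "d2 > 0" and d2: "\<And>w w'. dist w w' < d2 \<Longrightarrow> dist (S w) (S w') < d1"
      using assms(1) \<open>d1 > 0\<close> unfolding uniformly_continuous_on_def by (metis UNIV_I)
    have "\<bar>\<mu> i (S (P x)) - \<mu> i (S (P x'))\<bar> < e"
      if "\<forall>j<n. \<bar>x j - x' j\<bar> < d2 / N" "i < n" for x x' i
    proof -
      have "norm (P x - P x') \<le> d2 / N * (\<Sum>i<n. norm (y i))"
        using P that(1) by blast
      also have "\<dots> < d2 / N * N"
        using \<open>d2 > 0\<close> \<open>N > 0\<close> by (intro mult_strict_left_mono) (auto simp: N_def)
      finally have "dist (P x) (P x') < d2"
        using \<open>N > 0\<close> by (simp add: dist_norm)
      then show ?thesis
        using d1 d2 SM \<open>i < n\<close> by blast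
    qed
    then show "\<exists>d>0. \<forall>x x'. (\<forall>j<n. x j \<in> {0..1}) \<longrightarrow> (\<forall>j<n. x' j \<in> {0..1}) \<longrightarrow>
        (\<forall>j<n. \<bar>x j - x' j\<bar> < d) \<longrightarrow> (\<forall>i<n. \<bar>\<mu> i (S (P x)) - \<mu> i (S (P x'))\<bar> < e)"
      using \<open>d2 > 0\<close> \<open>N > 0\<close> by (intro exI[of _ "d2 / N"]) auto
  qed blast
  show thesis
  proof (rule that[of "P x"])
    have "norm (P (\<lambda>i. \<mu> i (S (P x))) - P x) \<le> \<epsilon> / (2 * N) * (\<Sum>i<n. norm (y i))"
      by (rule P) (use x in blast)
    also have "\<dots> < \<epsilon> / (2 * N) * N"
      using \<open>\<epsilon> > 0\<close> \<open>N > 0\<close> by (intro mult_strict_left_mono) (auto simp: N_def)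
    also have "\<dots> = \<epsilon> / 2"
      using \<open>N > 0\<close> by simp
    finally have "norm (P (\<lambda>i. \<mu> i (S (P x))) - P x) < \<epsilon> / 2" .
    moreover have "norm (P (\<lambda>i. \<mu> i (S (P x))) - S (P x)) \<le> \<epsilon> / 2"
      using \<mu>y[OF SM, of "P x"] by (simp add: P_def)
    ultimately show "norm (S (P x) - P x) < \<epsilon>"
      by norm
  qed
qed

text \<open>The displacement \<open>norm (S z - z)\<close> attains its minimum on the compact
  \<open>M\<close>. If \<open>w\<close> is almost fixed, then \<open>S w\<close> lies in
  \<open>M\<close> and is almost fixed as well by uniform continuity, so the minimum is 0.\<close>

theorem schauder_uniformly_continuous:
  fixes S :: "'a::real_normed_vector \<Rightarrow> 'a"
  assumes S: "uniformly_continuous_on UNIV S" and "compact M" "range S \<subseteq> M"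
  shows "\<exists>x. S x = x"
proof -
  have "M \<noteq> {}"
    using assms(3) by auto
  have "continuous_on M S"
    using continuous_on_subset[OF uniformly_continuous_imp_continuous[OF S]] by simp
  then have "continuous_on M (\<lambda>z. norm (S z - z))"
    by (intro continuous_intros)
  from continuous_attains_inf[OF \<open>compact M\<close> \<open>M \<noteq> {}\<close> this]
  obtain x where x: "\<And>z. z \<in> M \<Longrightarrow> norm (S x - x) \<le> norm (S z - z)"
    by blast
  have "norm (S x - x) \<le> e" if "e > 0" for e
  proof -
    obtain d where "d > 0" and d: "\<And>z z'. dist z z' < d \<Longrightarrow> dist (S z) (S z') < e"
      using S \<open>e > 0\<close> unfolding uniformly_continuous_on_def by (metis UNIV_I)
    obtain w where "norm (S w - w) < d"
      using schauder_approx_fixed_point[OF assms \<open>d > 0\<close>] by blast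
    then show ?thesis
      using d[of "S w" w] x[of "S w"] assms(3) by (force simp: dist_norm)
  qed
  then have "norm (S x - x) \<le> 0"
    by (rule field_le_epsilon[of _ 0, simplified])
  then show ?thesis
    by auto
qed

section \<open>Variational inequalities with a coercive bilinear form\<close>

text \<open>
  The pair \<open>(v, r)\<close> minimises \<open>\<parallel>u\<parallel>\<^sup>2 / 2 - l u + \<rho> s\<close> over \<open>E\<close>, and the inequality is the first-order
  condition. By the parallelogram law, the first components of a minimising sequence are Cauchy.
\<close>

lemma quadratic_minimizer_on_closed_convex:
  fixes E :: "('a::{real_inner, complete_space} \<times> real) set"
  assumes "closed E" "convex E" "E \<noteq> {}" and E0: "\<And>u s. (u, s) \<in> E \<Longrightarrow> 0 \<le> s"
    and l: "bounded_linear l" and "\<rho> > 0"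
  shows "\<exists>v r. (v, r) \<in> E \<and> (\<forall>(u, s)\<in>E. l (u - v) \<le> v \<bullet> (u - v) + \<rho> * (s - r))"
proof -
  interpret l: bounded_linear l by (rule l)
  define q where "q = (\<lambda>(u, s). (u \<bullet> u) / 2 - l u + \<rho> * s)"
  obtain L where L: "\<And>u. \<bar>l u\<bar> \<le> norm u * L"
    using l.bounded by (auto simp: real_norm_def)
  have q_lower: "- (L\<^sup>2 / 2) \<le> q x" if "x \<in> E" for x
  proof -
    obtain u s where x: "x = (u, s)" by force
    have "0 \<le> (norm u - L)\<^sup>2 / 2 + \<rho> * s"
      using E0 \<open>\<rho> > 0\<close> that x by simp
    also have "\<dots> = norm u * norm u / 2 - norm u * L + L\<^sup>2 / 2 + \<rho> * s"
      by (simp add: power2_eq_square field_simps)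
    also have "\<dots> \<le> norm u * norm u / 2 - l u + L\<^sup>2 / 2 + \<rho> * s"
      using L[of u] by simp
    finally show ?thesis
      by (simp add: q_def x flip: power2_norm_eq_inner power2_eq_square)
  qed
  define m where "m = Inf (q ` E)"
  have bdd: "bdd_below (q ` E)"
    by (rule bdd_belowI2[OF q_lower])
  have m_le: "m \<le> q x" if "x \<in> E" for x
    unfolding m_def by (rule cINF_lower[OF bdd that])
  have "\<exists>x\<in>E. q x < m + 1 / Suc n" for n
    using cInf_lessD[of "q ` E" "m + 1 / Suc n"] \<open>E \<noteq> {}\<close> by (auto simp: m_def)
  then obtain x where xE: "\<And>n. x n \<in> E" and xq: "\<And>n. q (x n) < m + 1 / Suc n"
    by metis
  define u s where "u = fst \<circ> x" and "s = snd \<circ> x"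
  have x: "x n = (u n, s n)" for n
    by (simp add: u_def s_def)
  \<comment> \<open>The terms of \<open>q\<close> that are linear in the pair average exactly, so
    the deficit comes from the quadratic term alone.\<close>
  have q_mid: "q ((1/2) *\<^sub>R y + (1/2) *\<^sub>R z) = q y / 2 + q z / 2 - (norm (fst y - fst z))\<^sup>2 / 8"
    for y z :: "'a \<times> real"
  proof -
    obtain a r b t where "y = (a, r)" "z = (b, t)" by force
    then show ?thesis
      by (simp add: q_def l.add l.scaleR power2_norm_eq_inner inner_simps
          inner_commute[of b a] field_simps)
  qed
  have gap: "(norm (u i - u j))\<^sup>2 \<le> 8 / Suc (min i j)" for i j
  proof -
    have "(1/2) *\<^sub>R x i + (1/2) *\<^sub>R x j \<in> E"
      using \<open>convex E\<close> xE by (intro convexD) auto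
    from m_le[OF this] have "(norm (u i - u j))\<^sup>2 / 8 \<le> q (x i) / 2 + q (x j) / 2 - m"
      unfolding q_mid by (simp add: u_def)
    also have "\<dots> \<le> 1 / Suc i / 2 + 1 / Suc j / 2"
    proof -
      have "a / 2 + b / 2 - m \<le> c / 2 + d / 2" if "a < m + c" "b < m + d" for a b c d
        using that by linarith
      then show ?thesis
        using xq by blast
    qed
    also have "\<dots> \<le> 1 / Suc (min i j) / 2 + 1 / Suc (min i j) / 2"
      by (intro add_mono divide_right_mono divide_left_mono) auto
    finally show ?thesis
      by (simp add: field_simps)
  qed
  have "Cauchy u"
  proof (rule metric_CauchyI)
    fix e :: real
    assume "e > 0"
    then obtain N where N: "8 / e\<^sup>2 < real N"
      using reals_Archimedean2 by blast
    have "dist (u i) (u j) < e" if "i \<ge> N" "j \<ge> N" for i j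
    proof -
      have "8 / e\<^sup>2 < Suc (min i j)"
        using N that by linarith
      then have "8 / Suc (min i j) < e\<^sup>2"
        using \<open>e > 0\<close> by (simp add: field_simps)
      then have "(norm (u i - u j))\<^sup>2 < e\<^sup>2"
        using gap[of i j] by linarith
      then show ?thesis
        unfolding dist_norm by (rule power2_less_imp_less) (use \<open>e > 0\<close> in simp)
    qed
    then show "\<exists>N. \<forall>i\<ge>N. \<forall>j\<ge>N. dist (u i) (u j) < e"
      by blast
  qed
  then obtain v where v: "u \<longlonglongrightarrow> v"
    by (metis Cauchy_convergent_iff convergent_def)
  have "(\<lambda>n. q (x n)) \<longlonglongrightarrow> m"
  proof (rule tendsto_sandwich[of "\<lambda>_. m" _ _ "\<lambda>n. m + 1 / Suc n"])
    show "(\<lambda>n. m + 1 / Suc n) \<longlonglongrightarrow> m"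
      using tendsto_add[OF tendsto_const[of m] LIMSEQ_inverse_real_of_nat]
      by (simp add: inverse_eq_divide)
  qed (simp_all add: m_le[OF xE] less_imp_le[OF xq] del: of_nat_Suc)
  \<comment> \<open>The Cauchy estimate says nothing about the second components. Solving
    \<open>q (x n)\<close> for \<open>s n\<close>, possible as \<rho> is nonzero, gives their
    limit.\<close>
  then have "(\<lambda>n. (q (x n) - (u n \<bullet> u n) / 2 + l (u n)) / \<rho>) \<longlonglongrightarrow> (m - (v \<bullet> v) / 2 + l v) / \<rho>"
    using v \<open>\<rho> > 0\<close> by (intro tendsto_intros l.tendsto) auto
  then have s: "s \<longlonglongrightarrow> (m - (v \<bullet> v) / 2 + l v) / \<rho>"
    using \<open>\<rho> > 0\<close> by (simp add: x q_def)
  define r where "r = (m - (v \<bullet> v) / 2 + l v) / \<rho>"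
  have "x \<longlonglongrightarrow> (v, r)"
    using tendsto_Pair[OF v s] by (simp add: r_def flip: x)
  then have vr: "(v, r) \<in> E"
    using \<open>closed E\<close> xE closed_sequentially by blast
  have qvr: "q (v, r) = m"
    using \<open>\<rho> > 0\<close> by (simp add: q_def r_def)
  have "l (w - v) \<le> v \<bullet> (w - v) + \<rho> * (t - r)" if "(w, t) \<in> E" for w t
  proof -
    \<comment> \<open>\<open>d\<close> is the directional derivative of \<open>q\<close> at
      \<open>(v, r)\<close> towards \<open>(w, t)\<close>. It is nonnegative by minimality along the
      segment: expand, divide by \<open>k\<close>, and let \<open>k\<close> tend to 0 from the
      right.\<close>
    define d where "d = v \<bullet> (w - v) + \<rho> * (t - r) - l (w - v)"
    have *: "0 \<le> d + k * ((norm (w - v))\<^sup>2 / 2)" if "0 < k" "k < 1" for k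
    proof -
      have "(1 - k) *\<^sub>R (v, r) + k *\<^sub>R (w, t) \<in> E"
        using \<open>convex E\<close> vr \<open>(w, t) \<in> E\<close> that by (intro convexD) auto
      moreover have "(1 - k) *\<^sub>R (v, r) + k *\<^sub>R (w, t) = (v + k *\<^sub>R (w - v), r + k * (t - r))"
        by (simp add: algebra_simps)
      ultimately have "q (v, r) \<le> q (v + k *\<^sub>R (w - v), r + k * (t - r))"
        using m_le qvr by metis
      moreover have "q (v + k *\<^sub>R h, r + k * p) = q (v, r) + k * (v \<bullet> h + \<rho> * p - l h + k * ((norm h)\<^sup>2 / 2))"
        for h p
        by (simp add: q_def l.add l.scaleR power2_norm_eq_inner inner_add_left inner_add_right
            inner_commute[of h v] field_simps)
      ultimately have "0 \<le> k * (d + k * ((norm (w - v))\<^sup>2 / 2))"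
        unfolding d_def by (metis le_add_same_cancel1)
      then show ?thesis
        using \<open>0 < k\<close> by (simp add: zero_le_mult_iff)
    qed
    have "((\<lambda>k. d + k * ((norm (w - v))\<^sup>2 / 2)) \<longlongrightarrow> d + 0 * ((norm (w - v))\<^sup>2 / 2)) (at_right 0)"
      by (intro tendsto_intros)
    moreover have "\<forall>\<^sub>F k in at_right 0. 0 \<le> d + k * ((norm (w - v))\<^sup>2 / 2)"
      unfolding eventually_at_right_field using * by (intro exI[of _ 1]) auto
    ultimately have "0 \<le> d + 0 * ((norm (w - v))\<^sup>2 / 2)"
      by (intro tendsto_lowerbound) auto
    then show ?thesis
      by (simp add: d_def)
  qed
  then show ?thesis
    using vr by blast
qed

text \<open>Over \<open>UNIV \<times> {0}\<close> the minimiser's inequality holds in every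
  direction, and testing it with \<open>v + h\<close> and \<open>v - h\<close> turns it into an
  equality.\<close>

corollary riesz_representation:
  fixes l :: "'a::{real_inner, complete_space} \<Rightarrow> real"
  assumes l: "bounded_linear l"
  obtains a where "\<And>h. l h = a \<bullet> h"
proof -
  interpret l: bounded_linear l by (rule l)
  have "closed (UNIV \<times> {0} :: ('a \<times> real) set)" "convex (UNIV \<times> {0} :: ('a \<times> real) set)"
    by (auto intro: closed_Times convex_Times)
  from quadratic_minimizer_on_closed_convex[OF this _ _ l, of 1]
  obtain v where v: "\<And>u. l (u - v) \<le> v \<bullet> (u - v)"
    by auto
  have "l h = v \<bullet> h" for h
    using v[of "v + h"] v[of "v - h"] by (simp add: l.neg)
  then show thesis
    by (rule that)
qed

text \<open>
  \<open>v\<close> solves the inequality iff it is the minimiser of the previous lemma for the functional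
  \<open>(v - \<rho> A v) \<bullet> _ + \<rho> l\<close>, where \<open>A\<close> represents \<open>b\<close>; this fixed point problem is contractive for
  \<open>\<rho> = \<alpha> / M\<^sup>2\<close>.
\<close>

lemma lions_stampacchia:
  fixes E :: "('a::{real_inner, complete_space} \<times> real) set" and b :: "'a \<Rightarrow> 'a \<Rightarrow> real"
  assumes E: "closed E" "convex E" "E \<noteq> {}" "\<And>u s. (u, s) \<in> E \<Longrightarrow> 0 \<le> s"
    and b: "bilinear b" and bound: "\<And>u v. \<bar>b u v\<bar> \<le> C * norm u * norm v"
    and "\<alpha> > 0" and coercive: "\<And>u. \<alpha> * (norm u)\<^sup>2 \<le> b u u"
    and l: "bounded_linear l"
  shows "\<exists>v r. (v, r) \<in> E \<and> (\<forall>(u, s)\<in>E. l (u - v) \<le> b v (u - v) + s - r)"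
proof -
  interpret l: bounded_linear l by (rule l)
  \<comment> \<open>In the zero space \<open>C\<close> may be negative or below \<alpha>. The
    maximum secures \<open>M > 0\<close> and \<open>\<alpha>\<^sup>2 / M\<^sup>2 \<le> 1\<close>, so
    that \<kappa> is a genuine square root.\<close>
  define M where "M = max C \<alpha>"
  have M: "\<bar>b u v\<bar> \<le> M * norm u * norm v" for u v
    unfolding M_def
    by (rule order_trans[OF bound]) (intro mult_right_mono max.cobounded1 norm_ge_zero)
  have "M \<ge> \<alpha>" "M > 0"
    using \<open>\<alpha> > 0\<close> by (auto simp: M_def)
  have "bounded_linear (b u)" for u
    using M[of u] by (intro bounded_linear_intro[of _ "M * norm u"])
      (simp_all add: bilinear_radd[OF b] bilinear_rmul[OF b] mult.commute)
  then have "\<exists>a. \<forall>h. b u h = a \<bullet> h" for u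
    by (metis riesz_representation)
  then obtain A where A: "\<And>u h. b u h = A u \<bullet> h"
    by metis
  \<comment> \<open>This value minimises
    \<open>1 - 2 * \<rho> * \<alpha> + \<rho>\<^sup>2 * M\<^sup>2\<close>, which bounds the squared
    Lipschitz constant of \<open>z\<close>; the minimum is \<open>\<kappa>\<^sup>2\<close>.\<close>
  define \<rho> where "\<rho> = \<alpha> / M\<^sup>2"
  have "\<rho> > 0"
    using \<open>\<alpha> > 0\<close> \<open>M > 0\<close> by (simp add: \<rho>_def)
  define \<kappa> where "\<kappa> = sqrt (1 - \<alpha>\<^sup>2 / M\<^sup>2)"
  have "\<alpha>\<^sup>2 / M\<^sup>2 \<le> 1" "\<alpha>\<^sup>2 / M\<^sup>2 > 0"
    using \<open>\<alpha> > 0\<close> \<open>M > 0\<close> \<open>M \<ge> \<alpha>\<close> by (auto simp: power_mono)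
  then have \<kappa>: "0 \<le> \<kappa>" "\<kappa> < 1"
    by (auto simp: \<kappa>_def)
  define z where "z = (\<lambda>w. w - \<rho> *\<^sub>R A w)"
  have z: "norm (z w - z w') \<le> \<kappa> * norm (w - w')" for w w'
  proof -
    define d where "d = w - w'"
    have Ad: "(A w - A w') \<bullet> h = b d h" for h
      by (simp add: d_def bilinear_lsub[OF b] inner_diff_left flip: A)
    have "(norm (A w - A w'))\<^sup>2 \<le> M * norm d * norm (A w - A w')"
      using M[of d "A w - A w'"] Ad[of "A w - A w'"] by (simp add: power2_norm_eq_inner)
    then have "norm (A w - A w') \<le> M * norm d"
      using \<open>M > 0\<close> by (cases "A w = A w'") (auto simp: power2_eq_square)
    then have "(norm (A w - A w'))\<^sup>2 \<le> M\<^sup>2 * (norm d)\<^sup>2"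
      using power_mono[of _ _ 2] by (fastforce simp: power_mult_distrib)
    have "(norm (z w - z w'))\<^sup>2 = (norm (d - \<rho> *\<^sub>R (A w - A w')))\<^sup>2"
      by (simp add: z_def d_def algebra_simps)
    also have "\<dots> = (norm d)\<^sup>2 - 2 * \<rho> * b d d + \<rho>\<^sup>2 * (norm (A w - A w'))\<^sup>2"
      unfolding Ad[symmetric] power2_norm_eq_inner
      by (simp add: inner_diff_left inner_diff_right inner_commute algebra_simps power2_eq_square)
    also have "\<dots> \<le> (norm d)\<^sup>2 - 2 * \<rho> * (\<alpha> * (norm d)\<^sup>2) + \<rho>\<^sup>2 * (M\<^sup>2 * (norm d)\<^sup>2)"
      using \<open>\<rho> > 0\<close> coercive[of d] \<open>(norm (A w - A w'))\<^sup>2 \<le> M\<^sup>2 * (norm d)\<^sup>2\<close>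
      by (intro add_mono diff_mono mult_left_mono) auto
    also have "\<dots> = (1 - \<alpha>\<^sup>2 / M\<^sup>2) * (norm d)\<^sup>2"
      using \<open>M > 0\<close> by (simp add: \<rho>_def field_simps power2_eq_square)
    also have "\<dots> = (\<kappa> * norm d)\<^sup>2"
      using \<open>\<alpha>\<^sup>2 / M\<^sup>2 \<le> 1\<close> by (simp add: \<kappa>_def power_mult_distrib)
    finally show ?thesis
      using power2_le_imp_le \<kappa>(1) by (metis d_def mult_nonneg_nonneg norm_ge_zero)
  qed
  have "\<exists>v r. (v, r) \<in> E \<and> (\<forall>(u, s)\<in>E. z w \<bullet> (u - v) + \<rho> * l (u - v) \<le> v \<bullet> (u - v) + \<rho> * (s - r))"
    for w
    by (rule quadratic_minimizer_on_closed_convex[OF E _ \<open>\<rho> > 0\<close>])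
      (auto intro!: bounded_linear_add bounded_linear_inner_right bounded_linear_const_mult l)
  then obtain S R where SR: "\<And>w. (S w, R w) \<in> E"
    and S: "\<And>w u s. (u, s) \<in> E \<Longrightarrow>
      z w \<bullet> (u - S w) + \<rho> * l (u - S w) \<le> S w \<bullet> (u - S w) + \<rho> * (s - R w)"
    by (metis (no_types, lifting) case_prodD)
  \<comment> \<open>Test each minimiser's inequality with the other minimiser and add: the terms in
    \<open>l\<close> and \<open>R\<close> cancel, so \<open>S\<close> expands no distance between
    \<open>z w\<close> and \<open>z w'\<close>.\<close>
  have "dist (S w) (S w') \<le> \<kappa> * dist w w'" for w w'
  proof -
    have "norm (S w - S w') * norm (S w - S w') \<le> (z w - z w') \<bullet> (S w - S w')"
      using S[OF SR, of w w'] S[OF SR, of w' w]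
      unfolding power2_eq_square[symmetric] power2_norm_eq_inner
      by (simp add: inner_diff_left inner_diff_right inner_commute l.diff algebra_simps)
    also have "\<dots> \<le> norm (z w - z w') * norm (S w - S w')"
      by (rule norm_cauchy_schwarz)
    finally have "norm (S w - S w') \<le> norm (z w - z w')"
      by (cases "S w = S w'") auto
    then show ?thesis
      using z[of w w'] by (simp add: dist_norm)
  qed
  then obtain v where "S v = v"
    using banach_fix_type[OF \<kappa>, of S] by auto
  have "(v, R v) \<in> E"
    using SR[of v] \<open>S v = v\<close> by simp
  moreover have "l (u - v) \<le> b v (u - v) + s - R v" if "(u, s) \<in> E" for u s
  proof -
    have "\<rho> * l (u - v) \<le> \<rho> * (b v (u - v) + s - R v)"
      using S[OF that, of v] \<open>S v = v\<close> by (simp add: z_def A inner_diff_left algebra_simps)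
    then show ?thesis
      using \<open>\<rho> > 0\<close> by simp
  qed
  ultimately show ?thesis
    by blast
qed

section \<open>Epigraphs and the full variational inequality\<close>

text \<open>The second component is real, so points where \<open>J\<close> is infinite drop out and
  inequalities over the set are ordinary real ones.\<close>

definition real_epigraph :: "('a \<Rightarrow> ereal) \<Rightarrow> ('a \<times> real) set" where
  "real_epigraph J = {(u, r). J u \<le> ereal r}"

lemma real_epigraph_nonneg:
  assumes "\<And>u. 0 \<le> J u" "(u, s) \<in> real_epigraph J"
  shows "0 \<le> s"
  using order_trans[OF assms(1)[of u], of "ereal s"] assms(2) by (simp add: real_epigraph_def)

lemma bilinear_add_trilinear:
  assumes "bilinear a\<^sub>0" "trilinear a\<^sub>1"
  shows "bilinear (\<lambda>u v. a\<^sub>0 u v + a\<^sub>1 w u v)"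
  using assms unfolding bilinear_def trilinear_def by (auto intro: linear_compose_add)

text \<open>If the limit \<open>(u, r)\<close> lay below the graph, a real \<open>c\<close> strictly
  between \<open>r\<close> and \<open>J u\<close> would eventually exceed the heights of the
  sequence and lie below the values of \<open>J\<close>.\<close>

lemma closed_real_epigraph:
  fixes J :: "'a::metric_space \<Rightarrow> ereal"
  assumes "lower_semicontinuous J"
  shows "closed (real_epigraph J)"
  unfolding closed_sequential_limits
proof (intro allI impI, elim conjE)
  fix x l
  assume x: "\<forall>n. x n \<in> real_epigraph J" and "x \<longlonglongrightarrow> l"
  obtain u r where l: "l = (u, r)" by force
  have u: "(\<lambda>n. fst (x n)) \<longlonglongrightarrow> u" and r: "(\<lambda>n. snd (x n)) \<longlonglongrightarrow> r"
    using tendsto_fst[OF \<open>x \<longlonglongrightarrow> l\<close>] tendsto_snd[OF \<open>x \<longlonglongrightarrow> l\<close>] by (simp_all add: l)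
  have "J u \<le> ereal r"
  proof (rule ccontr)
    assume "\<not> J u \<le> ereal r"
    then obtain c where c: "r < c" "ereal c < J u"
      using ereal_dense2[of "ereal r" "J u"] by (auto simp: not_le)
    then have "\<forall>\<^sub>F y in at u. ereal c < J y"
      using assms unfolding lower_semicontinuous_def le_Liminf_iff by blast
    \<comment> \<open>The filter \<open>at u\<close> omits \<open>u\<close>, which the sequence may
      hit; there \<open>c < J u\<close> supplies the bound.\<close>
    then have "\<forall>\<^sub>F y in nhds u. ereal c < J y"
      using c(2) by (auto simp: eventually_at_filter elim: eventually_mono)
    then have "\<forall>\<^sub>F n in sequentially. ereal c < J (fst (x n))"
      using u by (rule eventually_compose_filterlim)
    moreover have "\<forall>\<^sub>F n in sequentially. snd (x n) < c"
      using order_tendstoD(2)[OF r \<open>r < c\<close>] .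
    ultimately have "\<forall>\<^sub>F n in sequentially. False"
    proof eventually_elim
      case (elim n)
      have "J (fst (x n)) \<le> ereal (snd (x n))"
        using x by (auto simp: real_epigraph_def case_prod_beta)
      also have "\<dots> < ereal c"
        using elim by simp
      finally show ?case
        using elim by simp
    qed
    then show False
      by simp
  qed
  then show "l \<in> real_epigraph J"
    by (simp add: real_epigraph_def l)
qed

lemma convex_real_epigraph:
  assumes "convex_functional J"
  shows "convex (real_epigraph J)"
proof (rule convexI, clarify)
  fix u r v t and p q :: real
  assume "(u, r) \<in> real_epigraph J" "(v, t) \<in> real_epigraph J" and pq: "0 \<le> p" "0 \<le> q" "p + q = 1"
  then have "ereal p * J u + ereal q * J v \<le> ereal p * ereal r + ereal q * ereal t"
    by (intro add_mono ereal_mult_left_mono) (auto simp: real_epigraph_def)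
  moreover have "J (p *\<^sub>R u + q *\<^sub>R v) \<le> ereal p * J u + ereal q * J v"
    using assms pq unfolding convex_functional_def by blast
  ultimately have "J (p *\<^sub>R u + q *\<^sub>R v) \<le> ereal (p * r + q * t)"
    by simp
  then show "p *\<^sub>R (u, r) + q *\<^sub>R (v, t) \<in> real_epigraph J"
    by (simp add: real_epigraph_def)
qed

text \<open>From left to right \<open>r\<close> is the value \<open>J v\<close>. Conversely any
  \<open>r \<ge> J v\<close> will do, since subtracting a larger \<open>r\<close> only strengthens
  the inequality, and where \<open>J u\<close> is infinite the inequality is trivial because
  \<open>J v\<close> is finite.\<close>

lemma vi_solution_iff_epigraph:
  assumes "\<And>u. 0 \<le> J u"
  shows "vi_solution \<iota> a\<^sub>0 a\<^sub>1 J f v \<longleftrightarrow>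
    (\<exists>r. (v, r) \<in> real_epigraph J \<and>
      (\<forall>(u, s)\<in>real_epigraph J. f (u - v) \<le> a\<^sub>0 v (u - v) + a\<^sub>1 (\<iota> v) v (u - v) + s - r))"
    (is "?L \<longleftrightarrow> (\<exists>r. ?R r)")
proof
  assume L: ?L
  then obtain r where r: "J v = ereal r"
    using assms[of v] unfolding vi_solution_def by (cases "J v") auto
  have "f (u - v) \<le> a\<^sub>0 v (u - v) + a\<^sub>1 (\<iota> v) v (u - v) + s - r" if le: "J u \<le> ereal s" for u s
  proof -
    obtain t where t: "J u = ereal t"
      using assms[of u] le by (cases "J u") auto
    have "ereal (f (u - v)) \<le> ereal (a\<^sub>0 v (u - v) + a\<^sub>1 (\<iota> v) v (u - v)) + J u - J v"
      using L by (simp add: vi_solution_def)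
    then show ?thesis
      using le by (simp add: r t)
  qed
  then show "\<exists>r. ?R r"
    by (intro exI[of _ r]) (auto simp: real_epigraph_def r)
next
  assume "\<exists>r. ?R r"
  then obtain r where r: "J v \<le> ereal r"
    and ineq: "\<And>u s. J u \<le> ereal s \<Longrightarrow> f (u - v) \<le> a\<^sub>0 v (u - v) + a\<^sub>1 (\<iota> v) v (u - v) + s - r"
    by (auto simp: real_epigraph_def)
  from r obtain t where t: "J v = ereal t"
    using assms[of v] by (cases "J v") auto
  have "ereal (f (u - v)) \<le> ereal (a\<^sub>0 v (u - v) + a\<^sub>1 (\<iota> v) v (u - v)) + J u - J v" for u
  proof (cases "J u")
    case (real s)
    then show ?thesis
      using ineq[of u s] r by (simp add: t)
  qed (use assms[of u] in \<open>auto simp: t\<close>)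
  then show ?L
    by (simp add: vi_solution_def t)
qed

section \<open>A priori bound and comparison estimate over an epigraph\<close>

text \<open>Testing with \<open>(0, 0)\<close> gives
  \<open>\<alpha> * (norm v)\<^sup>2 \<le> b v v \<le> f v\<close>. A general \<open>b\<close>
  covers both the problem with \<open>w\<close> fixed and the full inequality.\<close>

lemma epigraph_vi_norm_bound:
  fixes b :: "'a::real_normed_vector \<Rightarrow> 'a \<Rightarrow> real" and f :: "'a \<Rightarrow>\<^sub>L real"
  assumes "bilinear b" "\<alpha> > 0" and coercive: "\<alpha> * (norm v)\<^sup>2 \<le> b v v"
    and "(0, 0) \<in> E" "0 \<le> r" and vi: "\<And>u s. (u, s) \<in> E \<Longrightarrow> f (u - v) \<le> b v (u - v) + s - r"
  shows "norm v \<le> 1 / \<alpha> * norm f"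
proof -
  have "\<alpha> * (norm v)\<^sup>2 \<le> f v"
    using vi[OF \<open>(0, 0) \<in> E\<close>] coercive \<open>0 \<le> r\<close>
    by (simp add: bilinear_rneg[OF \<open>bilinear b\<close>] blinfun.minus_right)
  also have "\<dots> \<le> norm f * norm v"
    using norm_blinfun[of f v] by simp
  finally have "\<alpha> * norm v \<le> norm f"
    by (cases "v = 0") (auto simp: power2_eq_square)
  then show ?thesis
    using \<open>\<alpha> > 0\<close> by (simp add: field_simps)
qed

text \<open>Each inequality is tested with the other solution and the two are added, which cancels
  \<open>f\<close>, \<open>r\<close> and \<open>r'\<close>. With free \<open>w\<close> this gives
  the Lipschitz bound for the solution map, with \<open>w = \<iota> v\<close> and
  \<open>w' = \<iota> v'\<close> it gives uniqueness.\<close>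

lemma epigraph_vi_difference:
  fixes a\<^sub>0 :: "'a::real_normed_vector \<Rightarrow> 'a \<Rightarrow> real" and f :: "'a \<Rightarrow>\<^sub>L real"
    and a\<^sub>1 :: "'b::real_normed_vector \<Rightarrow> 'a \<Rightarrow> 'a \<Rightarrow> real"
  assumes a0: "bilinear a\<^sub>0" "\<And>u. \<alpha> * (norm u)\<^sup>2 \<le> a\<^sub>0 u u"
    and a1: "trilinear a\<^sub>1" "\<And>w u. a\<^sub>1 w u u = 0"
      "\<And>w u v. \<bar>a\<^sub>1 w u v\<bar> \<le> K * norm w * norm u * norm v"
    and v: "(v, r) \<in> E" "\<And>u s. (u, s) \<in> E \<Longrightarrow> f (u - v) \<le> a\<^sub>0 v (u - v) + a\<^sub>1 w v (u - v) + s - r"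
    and v': "(v', r') \<in> E"
      "\<And>u s. (u, s) \<in> E \<Longrightarrow> f (u - v') \<le> a\<^sub>0 v' (u - v') + a\<^sub>1 w' v' (u - v') + s - r'"
    and "v \<noteq> v'"
  shows "\<alpha> * norm (v - v') \<le> K * norm (w - w') * norm v'"
proof -
  define d where "d = v - v'"
  have lin: "linear (\<lambda>w. a\<^sub>1 w u h)" "linear (\<lambda>u. a\<^sub>1 w u h)" "linear (\<lambda>h. a\<^sub>1 w u h)" for w u h
    using a1(1) by (auto simp: trilinear_def)
  have "v' - v = - d" "v = v' + d"
    by (simp_all add: d_def)
  then have "a\<^sub>0 d d + a\<^sub>1 w v d - a\<^sub>1 w' v' d \<le> 0"
    using v(2)[OF v'(1)] v'(2)[OF v(1)] linear_neg[OF lin(3)]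
    by (simp add: bilinear_rneg[OF a0(1)] bilinear_ladd[OF a0(1)] blinfun.minus_right)
  \<comment> \<open>Writing \<open>v = v' + d\<close>, the term \<open>a\<^sub>1 w d d\<close>
    vanishes, so only the change of the first argument remains.\<close>
  moreover have "a\<^sub>1 w v d - a\<^sub>1 w' v' d = a\<^sub>1 (w - w') v' d"
    using linear_add[OF lin(2), of w v' d d] linear_diff[OF lin(1), of w w' v' d] a1(2)
    by (simp add: \<open>v = v' + d\<close>)
  ultimately have "\<alpha> * (norm d)\<^sup>2 \<le> K * norm (w - w') * norm v' * norm d"
    using a0(2)[of d] a1(3)[of "w - w'" v' d] by linarith
  then show ?thesis
    using \<open>v \<noteq> v'\<close> by (auto simp: d_def power2_eq_square)
qed

section \<open>Bound, uniqueness and existence for the full inequality\<close>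

lemma vi_solution_norm_bound:
  fixes a\<^sub>0 :: "'a::real_normed_vector \<Rightarrow> 'a \<Rightarrow> real" and a\<^sub>1 :: "'b::real_normed_vector \<Rightarrow> 'a \<Rightarrow> 'a \<Rightarrow> real"
  assumes J: "\<And>u. 0 \<le> J u" "J 0 = 0"
    and a0: "bilinear a\<^sub>0" "\<And>u. \<alpha> * (norm u)\<^sup>2 \<le> a\<^sub>0 u u"
    and a1: "trilinear a\<^sub>1" "\<And>w u. a\<^sub>1 w u u = 0"
    and "\<alpha> > 0" and sol: "vi_solution \<iota> a\<^sub>0 a\<^sub>1 J f v"
  shows "norm v \<le> 1 / \<alpha> * norm f"
proof -
  obtain r where r: "(v, r) \<in> real_epigraph J"
    and vi: "\<And>u s. (u, s) \<in> real_epigraph J \<Longrightarrow> f (u - v) \<le> a\<^sub>0 v (u - v) + a\<^sub>1 (\<iota> v) v (u - v) + s - r"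
    using sol unfolding vi_solution_iff_epigraph[OF J(1)] by blast
  show ?thesis
  proof (rule epigraph_vi_norm_bound[OF bilinear_add_trilinear[OF a0(1) a1(1)] \<open>\<alpha> > 0\<close> _ _ _ vi])
    show "\<alpha> * (norm v)\<^sup>2 \<le> a\<^sub>0 v v + a\<^sub>1 (\<iota> v) v v"
      using a0(2) a1(2) by simp
    show "(0, 0) \<in> real_epigraph J"
      using J(2) by (simp add: real_epigraph_def)
    show "0 \<le> r"
      using real_epigraph_nonneg[OF J(1) r] .
  qed
qed

text \<open>Inserting the embedding constant and the a priori bound on \<open>v'\<close> into the
  comparison estimate bounds \<open>norm (v - v')\<close> by itself times a factor below 1.\<close>

lemma vi_solution_unique:
  fixes a\<^sub>0 :: "'a::real_normed_vector \<Rightarrow> 'a \<Rightarrow> real" and a\<^sub>1 :: "'b::real_normed_vector \<Rightarrow> 'a \<Rightarrow> 'a \<Rightarrow> real"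
  assumes J: "\<And>u. 0 \<le> J u" "J 0 = 0"
    and a0: "bilinear a\<^sub>0" "\<And>u. \<alpha> * (norm u)\<^sup>2 \<le> a\<^sub>0 u u" "\<And>u v. \<bar>a\<^sub>0 u v\<bar> \<le> K * norm u * norm v"
    and a1: "trilinear a\<^sub>1" "\<And>w u. a\<^sub>1 w u u = 0"
      "\<And>w u v. \<bar>a\<^sub>1 w u v\<bar> \<le> K * norm w * norm u * norm v"
    and \<alpha>: "\<alpha> > 0" and "linear \<iota>"
    and c: "\<And>u. norm (\<iota> u) \<le> c * norm u" and small: "K * c / \<alpha>\<^sup>2 * norm f < 1"
    and sol: "vi_solution \<iota> a\<^sub>0 a\<^sub>1 J f v" "vi_solution \<iota> a\<^sub>0 a\<^sub>1 J f v'"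
  shows "v = v'"
proof (rule ccontr)
  assume "v \<noteq> v'"
  obtain r r' where r: "(v, r) \<in> real_epigraph J"
      "\<And>u s. (u, s) \<in> real_epigraph J \<Longrightarrow> f (u - v) \<le> a\<^sub>0 v (u - v) + a\<^sub>1 (\<iota> v) v (u - v) + s - r"
    and r': "(v', r') \<in> real_epigraph J"
      "\<And>u s. (u, s) \<in> real_epigraph J \<Longrightarrow> f (u - v') \<le> a\<^sub>0 v' (u - v') + a\<^sub>1 (\<iota> v') v' (u - v') + s - r'"
    using sol unfolding vi_solution_iff_epigraph[OF J(1)] by blast
  have pos: "norm (v - v') > 0"
    using \<open>v \<noteq> v'\<close> by simp
  \<comment> \<open>The sign of \<open>K\<close> is not given; it follows from coercivity and
    boundedness of \<open>a\<^sub>0\<close> at the nonzero vector \<open>v - v'\<close>.\<close>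
  have "\<alpha> * (norm (v - v'))\<^sup>2 \<le> K * (norm (v - v'))\<^sup>2"
    using a0(2)[of "v - v'"] a0(3)[of "v - v'" "v - v'"]
    by (simp add: power2_eq_square mult.assoc)
  then have "K > 0"
    using pos \<alpha> by simp
  have \<iota>_le: "norm (\<iota> v - \<iota> v') \<le> c * norm (v - v')"
    using c[of "v - v'"] by (simp add: linear_diff[OF \<open>linear \<iota>\<close>])
  have "\<alpha> * norm (v - v') \<le> K * norm (\<iota> v - \<iota> v') * norm v'"
    using epigraph_vi_difference[OF a0(1,2) a1 r r' \<open>v \<noteq> v'\<close>] .
  also have "\<dots> \<le> K * (c * norm (v - v')) * (1 / \<alpha> * norm f)"
  proof (rule mult_mono)
    show "K * norm (\<iota> v - \<iota> v') \<le> K * (c * norm (v - v'))"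
      using \<iota>_le \<open>K > 0\<close> by (intro mult_left_mono) auto
    show "norm v' \<le> 1 / \<alpha> * norm f"
      using vi_solution_norm_bound[OF J a0(1,2) a1(1,2) \<alpha> sol(2)] .
    show "0 \<le> K * (c * norm (v - v'))"
      by (rule mult_nonneg_nonneg[OF less_imp_le[OF \<open>K > 0\<close>] order_trans[OF norm_ge_zero \<iota>_le]])
  qed simp
  also have "\<dots> = \<alpha> * (K * c / \<alpha>\<^sup>2 * norm f * norm (v - v'))"
    using \<alpha> by (simp add: field_simps power2_eq_square)
  finally have "norm (v - v') \<le> K * c / \<alpha>\<^sup>2 * norm f * norm (v - v')"
    unfolding mult_le_cancel_left_pos[OF \<alpha>] .
  then show False
    using mult_strict_right_mono[OF small pos] by linarith
qed

lemma vi_solution_exists: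
  fixes a\<^sub>0 :: "'a::{real_inner, complete_space} \<Rightarrow> 'a \<Rightarrow> real"
    and a\<^sub>1 :: "'b::real_normed_vector \<Rightarrow> 'a \<Rightarrow> 'a \<Rightarrow> real"
  assumes "compact_embedding \<iota>"
    and J: "\<And>u. 0 \<le> J u" "J 0 = 0" "lower_semicontinuous J" "convex_functional J"
    and a0: "bilinear a\<^sub>0" "\<And>u. \<alpha> * (norm u)\<^sup>2 \<le> a\<^sub>0 u u" "\<And>u v. \<bar>a\<^sub>0 u v\<bar> \<le> K * norm u * norm v"
    and a1: "trilinear a\<^sub>1" "\<And>w u. a\<^sub>1 w u u = 0"
      "\<And>w u v. \<bar>a\<^sub>1 w u v\<bar> \<le> K * norm w * norm u * norm v"
    and \<alpha>: "\<alpha> > 0"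
  shows "\<exists>v. vi_solution \<iota> a\<^sub>0 a\<^sub>1 J f v"
proof -
  define E where "E = real_epigraph J"
  have E: "closed E" "convex E" "(0, 0) \<in> E" "\<And>u s. (u, s) \<in> E \<Longrightarrow> 0 \<le> s"
    unfolding E_def
    by (rule closed_real_epigraph[OF J(3)], rule convex_real_epigraph[OF J(4)],
        simp add: real_epigraph_def J(2), rule real_epigraph_nonneg[OF J(1)])
  note bilin = bilinear_add_trilinear[OF a0(1) a1(1)]
  have coercive: "\<alpha> * (norm u)\<^sup>2 \<le> a\<^sub>0 u u + a\<^sub>1 w u u" for w u
    using a0(2) a1(2) by simp
  have "\<exists>v r. (v, r) \<in> E \<and> (\<forall>(u, s)\<in>E. f (u - v) \<le> a\<^sub>0 v (u - v) + a\<^sub>1 w v (u - v) + s - r)" for w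
  proof (rule lions_stampacchia[OF E(1,2) _ E(4) bilin _ \<alpha> coercive])
    \<comment> \<open>This bound grows with \<open>w\<close>, which is harmless: the a priori bound
      on \<open>T w\<close> involves only \<alpha> and \<open>f\<close>.\<close>
    show "\<bar>a\<^sub>0 u v + a\<^sub>1 w u v\<bar> \<le> (K + K * norm w) * norm u * norm v" for u v
      using a0(3)[of u v] a1(3)[of w u v] by (simp add: algebra_simps)
  qed (use E(3) in \<open>auto intro: blinfun.bounded_linear_right\<close>)
  then obtain T R where TR: "\<And>w. (T w, R w) \<in> E"
    and T: "\<And>w u s. (u, s) \<in> E \<Longrightarrow> f (u - T w) \<le> a\<^sub>0 (T w) (u - T w) + a\<^sub>1 w (T w) (u - T w) + s - R w"
    by (metis (no_types, lifting) case_prodD)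
  define \<rho> where "\<rho> = 1 / \<alpha> * norm f"
  have T_bound: "norm (T w) \<le> \<rho>" for w
    unfolding \<rho>_def
    using epigraph_vi_norm_bound[OF bilin \<alpha> coercive E(3) E(4)[OF TR] T] .
  \<comment> \<open>The comparison estimate concerns distinct solutions, hence the case split; the
    absolute value keeps the constant nonnegative.\<close>
  have T_lipschitz: "dist (T w) (T w') \<le> \<bar>K\<bar> * \<rho> / \<alpha> * dist w w'" for w w'
  proof (cases "T w = T w'")
    case False
    have "\<alpha> * norm (T w - T w') \<le> K * norm (w - w') * norm (T w')"
      using epigraph_vi_difference[OF a0(1,2) a1 TR T TR T False] .
    also have "\<dots> \<le> \<bar>K\<bar> * norm (w - w') * \<rho>"
      using T_bound by (intro mult_mono) auto
    finally show ?thesis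
      using \<alpha> by (simp add: dist_norm field_simps)
  qed (use \<alpha> in \<open>simp add: \<rho>_def\<close>)
  have \<iota>: "bounded_linear \<iota>" "compact (closure (\<iota> ` cball 0 \<rho>))"
    using assms(1) by (auto simp: compact_embedding_def continuous_embedding_def)
  have "uniformly_continuous_on UNIV T"
    using lipschitz_on_uniformly_continuous[OF lipschitz_onI[OF T_lipschitz]] \<alpha>
    by (simp add: \<rho>_def)
  then have "uniformly_continuous_on UNIV (\<lambda>w. \<iota> (T w))"
    by (rule bounded_linear.uniformly_continuous_on[OF \<iota>(1)])
  moreover have "range (\<lambda>w. \<iota> (T w)) \<subseteq> closure (\<iota> ` cball 0 \<rho>)"
    using T_bound closure_subset[of "\<iota> ` cball 0 \<rho>"] by auto
  ultimately obtain w where "\<iota> (T w) = w"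
    using schauder_uniformly_continuous[OF _ \<iota>(2)] by blast
  \<comment> \<open>The fixed point equation turns the fixed first argument \<open>w\<close> into
    \<open>\<iota> (T w)\<close>, which is the full inequality in epigraph form.\<close>
  then have "vi_solution \<iota> a\<^sub>0 a\<^sub>1 J f (T w)"
    unfolding vi_solution_iff_epigraph[OF J(1)] E_def[symmetric] using TR[of w] T[of _ _ w] by auto
  then show ?thesis ..
qed

theorem theorem4p1:
  fixes \<iota> :: "'x::{real_inner, complete_space} \<Rightarrow> 'y::{real_inner, complete_space}"
    and J :: "'x \<Rightarrow> ereal"
    and a\<^sub>0 :: "'x \<Rightarrow> 'x \<Rightarrow> real"
    and a\<^sub>1 :: "'y \<Rightarrow> 'x \<Rightarrow> 'x \<Rightarrow> real"
    and K \<alpha> :: real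
  assumes "separable_space (euclidean :: 'x topology)"
    and "separable_space (euclidean :: 'y topology)"
    and "compact_embedding \<iota>"
    and "\<And>u. 0 \<le> J u"
    and "proper_functional J"
    and "lower_semicontinuous J"
    and "convex_functional J"
    and "J 0 = 0"
    and "bilinear a\<^sub>0"
    and "\<And>u v. \<bar>a\<^sub>0 u v\<bar> \<le> K * norm u * norm v"
    and "\<alpha> > 0"
    and "\<And>u. a\<^sub>0 u u \<ge> \<alpha> * (norm u)\<^sup>2"
    and "trilinear a\<^sub>1"
    and "\<And>w u. a\<^sub>1 w u u = 0"
    and "\<And>w u v. \<bar>a\<^sub>1 w u v\<bar> \<le> K * norm w * norm u * norm v"
  shows "\<forall>f :: 'x \<Rightarrow>\<^sub>L real.
           (\<exists>v. vi_solution \<iota> a\<^sub>0 a\<^sub>1 J f v) \<and>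
           (\<forall>v. vi_solution \<iota> a\<^sub>0 a\<^sub>1 J f v \<longrightarrow> norm v \<le> 1 / \<alpha> * norm f) \<and>
           (\<forall>c. (\<forall>u. norm (\<iota> u) \<le> c * norm u) \<and> K * c / \<alpha>\<^sup>2 * norm f < 1 \<longrightarrow>
                (\<exists>!v. vi_solution \<iota> a\<^sub>0 a\<^sub>1 J f v))"
proof (intro allI conjI impI)
  fix f :: "'x \<Rightarrow>\<^sub>L real"
  note J = assms(4,8) and a0 = assms(9,12,10) and a1 = assms(13-15) and \<alpha> = assms(11)
  show ex: "\<exists>v. vi_solution \<iota> a\<^sub>0 a\<^sub>1 J f v"
    by (rule vi_solution_exists[OF assms(3) J assms(6,7) a0 a1 \<alpha>])
  show "norm v \<le> 1 / \<alpha> * norm f" if "vi_solution \<iota> a\<^sub>0 a\<^sub>1 J f v" for v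
    by (rule vi_solution_norm_bound[OF J a0(1,2) a1(1,2) \<alpha> that])
  have "linear \<iota>"
    using assms(3) by (simp add: compact_embedding_def continuous_embedding_def bounded_linear.linear)
  fix c
  assume c: "(\<forall>u. norm (\<iota> u) \<le> c * norm u) \<and> K * c / \<alpha>\<^sup>2 * norm f < 1"
  show "\<exists>!v. vi_solution \<iota> a\<^sub>0 a\<^sub>1 J f v"
  proof (rule ex_ex1I[OF ex])
    fix v v'
    assume sol: "vi_solution \<iota> a\<^sub>0 a\<^sub>1 J f v" "vi_solution \<iota> a\<^sub>0 a\<^sub>1 J f v'"
    have "norm (\<iota> u) \<le> c * norm u" for u
      using c by blast
    from vi_solution_unique[where \<iota> = \<iota> and J = J and a\<^sub>0 = a\<^sub>0 and a\<^sub>1 = a\<^sub>1 and f = f,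
        OF J a0 a1 \<alpha> \<open>linear \<iota>\<close> this conjunct2[OF c] sol]
    show "v = v'" .
  qed
qed

end
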